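(* For all predicates $s, s_1, s_2$ on the state, functions $\sigma:\Sigma\to\Sigma$, and trace expressions $t, t_1, t_2$: (1) $\Phi(s,\sigma,t) \,\mathbf{wp}_r\, \mathit{false} = \mathcal{I}(s,t)$; (2) $\Phi(s_1,\sigma,t_1)\,\mathbf{wp}_r\,\mathcal{I}(s_2,t_2) = \mathcal{I}(s_1\wedge \sigma\dagger s_2,\ t_1{}^\frown(\sigma\dagger t_2))$; (3) $\mathcal{I}(\mathit{false}, t) = \mathit{true}_r$; (4) $\mathcal{I}(\mathit{true},\langle\rangle) = \mathit{false}$; (5) $\mathcal{I}(s_1,t)\wedge\mathcal{I}(s_2,t) = \mathcal{I}(s_1\vee s_2, t)$; (6) $\mathcal{I}(s_1,t)\vee\mathcal{I}(s_2,t) = \mathcal{I}(s_1\wedge s_2, t)$.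
   Context: UTP setting: relations are predicates over undashed (initial) and dashed (final) variables; $;$ is relational composition; $P \lhd c \rhd Q = (c\wedge P)\vee(\neg c\wedge Q)$. Observational variables: booleans $ok,ok',wait,wait'$; traces $tr,tr'$ (finite sequences of events; $\le$ prefix, ${}^\frown$ concatenation, $-$ removal of a prefix); state $st,st'\in\Sigma$; refusal sets $ref,ref'$. $tt$ abbreviates $tr'-tr$. $\mathbf{R1}(P) = P\wedge tr\le tr'$; $\mathbf{R2}(P) = P[\langle\rangle,tr'-tr/tr,tr']\lhd tr\le tr'\rhd P$; $\mathbf{RR}(P) = \exists ok,ok',wait,wait'\bullet\mathbf{R1}(\mathbf{R2}(P))$; $\mathbf{RC}(P) = \mathbf{R1}(\mathbf{RR}(P);(tr'\le tr))$; $\mathbf{CRR}(P)=\exists ref\bullet\mathbf{RR}(P)$; $\mathbf{CRC}(P) = \exists ref\bullet\mathbf{RC}(P)$. $\mathit{true}_r = \mathbf{R1}(\mathit{true})$, $\neg_r P = \mathbf{R1}(\neg P)$, $P\Rightarrow_r Q = \neg_r P\vee Q$, $P\,\mathbf{wp}_r\,Q = \neg_r(P;\neg_r Q)$. For a predicate $s$ on $st$, a trace-valued expression $t$ over $st$ and a function $\sigma:\Sigma\to\Sigma$: $\mathcal{I}(s,t) = \mathbf{CRC}(s\Rightarrow_r\neg_r(t\le tt))$ and $\Phi(s,\sigma,t) = \mathbf{CRR}(s\wedge st'=\sigma(st)\wedge tt = t)$. For an expression $e$ over $st$, $\sigma\dagger e$ is $e$ with $st$ replaced by $\sigma(st)$.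 *)

theory Defs
  imports Main "HOL-Library.Sublist"
begin

record ('e, 's) obs =
  ok :: bool
  wait :: bool
  tr :: "'e list"
  st :: 's
  ref :: "'e set"

text \<open>The first argument of a relation carries the undashed variables, the second the
  dashed ones. The connectives of the alphabetised predicate calculus are the Boolean algebra
  operations on curried relations, and relational composition is \<^term>\<open>(OO)\<close>.\<close>

type_synonym ('e, 's) urel = "('e, 's) obs \<Rightarrow> ('e, 's) obs \<Rightarrow> bool"

definition ucond ::
  "('e, 's) urel \<Rightarrow> ('e, 's) urel \<Rightarrow> ('e, 's) urel \<Rightarrow> ('e, 's) urel"
    (\<open>(_ \<lhd> _ \<rhd> _)\<close> [52, 0, 53] 52) where
  "P \<lhd> c \<rhd> Q = sup (inf c P) (inf (- c) Q)"

text \<open>Totalised by the empty trace; only the case \<^prop>\<open>prefix ys xs\<close> matters, as all uses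
  below are guarded by \<open>R1\<close>.\<close>

definition trace_minus :: "'e list \<Rightarrow> 'e list \<Rightarrow> 'e list" (infixl \<open>\<ominus>\<close> 65) where
  "xs \<ominus> ys = (if prefix ys xs then drop (length ys) xs else [])"

abbreviation tt :: "('e, 's) obs \<Rightarrow> ('e, 's) obs \<Rightarrow> 'e list" where
  "tt x x' \<equiv> tr x' \<ominus> tr x"

abbreviation tr_le :: "('e, 's) urel" where
  "tr_le \<equiv> (\<lambda>x x'. prefix (tr x) (tr x'))"

abbreviation tr_ge :: "('e, 's) urel" where
  "tr_ge \<equiv> (\<lambda>x x'. prefix (tr x') (tr x))"

definition R1 :: "('e, 's) urel \<Rightarrow> ('e, 's) urel" where
  "R1 P = inf P tr_le"

definition R2 :: "('e, 's) urel \<Rightarrow> ('e, 's) urel" where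
  "R2 P = (\<lambda>x x'. P (x\<lparr>tr := []\<rparr>) (x'\<lparr>tr := tt x x'\<rparr>)) \<lhd> tr_le \<rhd> P"

definition RR :: "('e, 's) urel \<Rightarrow> ('e, 's) urel" where
  "RR P = (\<lambda>x x'. \<exists>k k' w w'. R1 (R2 P) (x\<lparr>ok := k, wait := w\<rparr>) (x'\<lparr>ok := k', wait := w'\<rparr>))"

definition RC :: "('e, 's) urel \<Rightarrow> ('e, 's) urel" where
  "RC P = R1 (RR P OO tr_ge)"

definition ex_ref :: "('e, 's) urel \<Rightarrow> ('e, 's) urel" where
  "ex_ref P = (\<lambda>x x'. \<exists>r. P (x\<lparr>ref := r\<rparr>) x')"

definition CRR :: "('e, 's) urel \<Rightarrow> ('e, 's) urel" where
  "CRR P = ex_ref (RR P)"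

definition CRC :: "('e, 's) urel \<Rightarrow> ('e, 's) urel" where
  "CRC P = ex_ref (RC P)"

definition true_r :: "('e, 's) urel" (\<open>true\<^sub>r\<close>) where
  "true\<^sub>r = R1 top"

definition not_r :: "('e, 's) urel \<Rightarrow> ('e, 's) urel" (\<open>\<not>\<^sub>r _\<close> [80] 80) where
  "\<not>\<^sub>r P = R1 (- P)"

definition impl_r :: "('e, 's) urel \<Rightarrow> ('e, 's) urel \<Rightarrow> ('e, 's) urel"
    (infixr \<open>\<Rightarrow>\<^sub>r\<close> 60) where
  "P \<Rightarrow>\<^sub>r Q = sup (\<not>\<^sub>r P) Q"

definition wp_r :: "('e, 's) urel \<Rightarrow> ('e, 's) urel \<Rightarrow> ('e, 's) urel"
    (infixr \<open>wp\<^sub>r\<close> 70) where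
  "P wp\<^sub>r Q = \<not>\<^sub>r (P OO \<not>\<^sub>r Q)"

definition state_subst :: "('s \<Rightarrow> 's) \<Rightarrow> ('s \<Rightarrow> 'a) \<Rightarrow> 's \<Rightarrow> 'a" (infixr \<open>\<dagger>\<close> 85) where
  "\<sigma> \<dagger> e = (\<lambda>s. e (\<sigma> s))"

definition I_rel :: "('s \<Rightarrow> bool) \<Rightarrow> ('s \<Rightarrow> 'e list) \<Rightarrow> ('e, 's) urel" (\<open>\<I>\<close>) where
  "\<I> s t = CRC ((\<lambda>x x'. s (st x)) \<Rightarrow>\<^sub>r \<not>\<^sub>r (\<lambda>x x'. prefix (t (st x)) (tt x x')))"

definition Phi_rel ::
  "('s \<Rightarrow> bool) \<Rightarrow> ('s \<Rightarrow> 's) \<Rightarrow> ('s \<Rightarrow> 'e list) \<Rightarrow> ('e, 's) urel" (\<open>\<Phi>\<close>) where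
  "\<Phi> s \<sigma> t = CRR (\<lambda>x x'. s (st x) \<and> st x' = \<sigma> (st x) \<and> tt x x' = t (st x))"

end

theory Submission
  imports Defs
begin

text \<open>Pointwise, \<open>\<I> s t\<close> says that the final trace extends \<open>tr\<close>, but does not extend
  \<open>tr @ t\<close> when \<open>s\<close> holds: composing with \<open>tr' \<le> tr\<close> inside \<open>RC\<close> is harmless because this
  condition is closed under shortening the final trace. Likewise \<open>\<Phi> s \<sigma> t\<close> fixes the final
  trace to \<open>tr @ t\<close> and the final state to \<open>\<sigma> st\<close>, so the intermediate observation of a
  weakest precondition is determined up to irrelevant variables. All six laws then reduce to
  propositional logic over prefixes.\<close>

lemma trace_minus_append [simp]: "(xs @ ys) \<ominus> xs = ys"
  by (simp add: trace_minus_def)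

lemma prefix_trace_minus_iff:
  "prefix xs ys \<Longrightarrow> prefix zs (ys \<ominus> xs) \<longleftrightarrow> prefix (xs @ zs) ys"
  by (auto elim: prefixE)

lemma trace_minus_eq_iff:
  "prefix xs ys \<Longrightarrow> ys \<ominus> xs = zs \<longleftrightarrow> ys = xs @ zs"
  by (auto elim: prefixE)

lemma RR_apply:
  "RR P x x' \<longleftrightarrow> prefix (tr x) (tr x') \<and>
    (\<exists>k k' w w'. P (x\<lparr>ok := k, wait := w, tr := []\<rparr>) (x'\<lparr>ok := k', wait := w', tr := tt x x'\<rparr>))"
  by (auto simp: RR_def R1_def R2_def ucond_def)

lemma I_rel_apply:
  "\<I> s t x x' \<longleftrightarrow>
    prefix (tr x) (tr x') \<and> (s (st x) \<longrightarrow> \<not> prefix (tr x @ t (st x)) (tr x'))"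
proof -
  have RR: "RR ((\<lambda>x x'. s (st x)) \<Rightarrow>\<^sub>r \<not>\<^sub>r (\<lambda>x x'. prefix (t (st x)) (tt x x'))) x y \<longleftrightarrow>
      prefix (tr x) (tr y) \<and> (s (st x) \<longrightarrow> \<not> prefix (tr x @ t (st x)) (tr y))"
    for x y :: "('b, 'a) obs"
    by (auto simp: RR_apply impl_r_def not_r_def R1_def prefix_trace_minus_iff)
  show ?thesis
    \<comment> \<open>The midpoint \<open>x'\<close> itself gives one direction, transitivity of
      prefix the other.\<close>
    unfolding I_rel_def CRC_def ex_ref_def RC_def R1_def
    by (auto simp: RR relcompp_apply intro: prefix_order.trans)
qed

lemma Phi_rel_apply:
  "\<Phi> s \<sigma> t x x' \<longleftrightarrow> s (st x) \<and> st x' = \<sigma> (st x) \<and> tr x' = tr x @ t (st x)"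
  by (auto simp: Phi_rel_def CRR_def ex_ref_def RR_apply trace_minus_eq_iff)

text \<open>The midpoint has free \<open>ok\<close>, \<open>wait\<close> and \<open>ref\<close>, so
  \<open>Q\<close> must ignore them; the prefix guard stems from the \<open>R1\<close> in
  \<open>\<not>\<^sub>r Q\<close>.\<close>

lemma Phi_wp_r_apply:
  assumes Q: "\<And>y y'. st y = \<sigma> (st x) \<Longrightarrow> tr y = tr x @ t (st x) \<Longrightarrow>
    tr y' = tr x' \<Longrightarrow> Q y y' \<longleftrightarrow> q (tr y')"
  shows "(\<Phi> s \<sigma> t wp\<^sub>r Q) x x' \<longleftrightarrow> prefix (tr x) (tr x') \<and>
    (s (st x) \<longrightarrow> prefix (tr x @ t (st x)) (tr x') \<longrightarrow> q (tr x'))"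
proof -
  \<comment> \<open>Without a midpoint the precondition would hold vacuously.\<close>
  have "\<exists>y. \<Phi> s \<sigma> t x y" if "s (st x)"
    using that by (intro exI[of _ "x\<lparr>st := \<sigma> (st x), tr := tr x @ t (st x)\<rparr>"])
      (simp add: Phi_rel_apply)
  then show ?thesis
    by (auto simp: wp_r_def not_r_def R1_def relcompp_apply Phi_rel_apply Q)
qed

theorem theorem16:
  fixes s s1 s2 :: "'s \<Rightarrow> bool"
    and \<sigma> :: "'s \<Rightarrow> 's"
    and t t1 t2 :: "'s \<Rightarrow> 'e list"
  shows "(\<Phi> s \<sigma> t) wp\<^sub>r bot = \<I> s t
    \<and> (\<Phi> s1 \<sigma> t1) wp\<^sub>r (\<I> s2 t2)
        = \<I> (\<lambda>v. s1 v \<and> (\<sigma> \<dagger> s2) v) (\<lambda>v. t1 v @ (\<sigma> \<dagger> t2) v)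
    \<and> \<I> (\<lambda>_. False) t = true\<^sub>r
    \<and> \<I> (\<lambda>_. True) (\<lambda>_. []) = (bot :: ('e, 's) urel)
    \<and> inf (\<I> s1 t) (\<I> s2 t) = \<I> (\<lambda>v. s1 v \<or> s2 v) t
    \<and> sup (\<I> s1 t) (\<I> s2 t) = \<I> (\<lambda>v. s1 v \<and> s2 v) t"
proof (intro conjI ext)
  fix x x' :: "('e, 's) obs"
  show "(\<Phi> s \<sigma> t wp\<^sub>r bot) x x' = \<I> s t x x'"
    by (subst Phi_wp_r_apply[where q = "\<lambda>_. False"]) (auto simp: I_rel_apply)
  show "(\<Phi> s1 \<sigma> t1 wp\<^sub>r \<I> s2 t2) x x' =
      \<I> (\<lambda>v. s1 v \<and> (\<sigma> \<dagger> s2) v) (\<lambda>v. t1 v @ (\<sigma> \<dagger> t2) v) x x'"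
    \<comment> \<open>Here \<open>q\<close> is \<open>\<I> s2 t2\<close> with the midpoint's trace
      and state filled in.\<close>
    by (subst Phi_wp_r_apply[where q = "\<lambda>u. prefix (tr x @ t1 (st x)) u \<and>
        (s2 (\<sigma> (st x)) \<longrightarrow> \<not> prefix (tr x @ t1 (st x) @ t2 (\<sigma> (st x))) u)"])
      (auto simp: I_rel_apply state_subst_def simp flip: append_assoc dest: append_prefixD)
qed (auto simp: I_rel_apply true_r_def R1_def)

end
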